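(* Let $Q$ be a finite connected subdirectly reducible locally strictly simple quandle. Then $Q\cong M\times N$ where $M$ and $N$ are connected strictly simple quandles.
   Context: A quandle is a set $Q$ with a binary operation $*$ such that every left translation $L_a:b\mapsto a*b$ is a bijection, $a*(b*c)=(a*b)*(a*c)$ and $a*a=a$. $Q$ is connected if the group generated by all $L_a$ is transitive on $Q$. Congruences are equivalence relations compatible with $*$ and left division; $0_Q$ is equality. $Q$ is subdirectly irreducible if the intersection of all congruences different from $0_Q$ is different from $0_Q$, and subdirectly reducible otherwise. A subquandle is proper if it has more than one element and is not all of $Q$. A quandle (with more than one element) is strictly simple if it has no proper subquandles, and locally strictly simple (LSS) if all its proper subquandles are strictly simple. *)

theory Defs
  imports "HOL-Algebra.Generated_Groups" "HOL-Algebra.Bij"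
begin

record 'a binar = "'a partial_object" +
  op :: "'a \<Rightarrow> 'a \<Rightarrow> 'a" (infixl "\<star>\<index>" 70)

locale quandle =
  fixes Q :: "('a, 'm) binar_scheme" (structure)
  assumes left_translation_bij:
      "a \<in> carrier Q \<Longrightarrow> bij_betw (\<lambda>b. a \<star> b) (carrier Q) (carrier Q)"
    and left_distrib:
      "\<lbrakk>a \<in> carrier Q; b \<in> carrier Q; c \<in> carrier Q\<rbrakk>
        \<Longrightarrow> a \<star> (b \<star> c) = (a \<star> b) \<star> (a \<star> c)"
    and idem: "a \<in> carrier Q \<Longrightarrow> a \<star> a = a"

text \<open>Left division: \<open>ldiv Q a b\<close> is the unique \<open>c\<close> in the carrier with \<open>a \<star> c = b\<close>.\<close>
definition ldiv :: "('a, 'm) binar_scheme \<Rightarrow> 'a \<Rightarrow> 'a \<Rightarrow> 'a" where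
  "ldiv Q a = inv_into (carrier Q) (op Q a)"

text \<open>Translations are restricted to the carrier because \<^const>\<open>BijGroup\<close> consists of
  extensional functions.\<close>
definition left_translation :: "('a, 'm) binar_scheme \<Rightarrow> 'a \<Rightarrow> 'a \<Rightarrow> 'a" where
  "left_translation Q a = restrict (op Q a) (carrier Q)"

definition left_mult_group :: "('a, 'm) binar_scheme \<Rightarrow> ('a \<Rightarrow> 'a) set" where
  "left_mult_group Q = generate (BijGroup (carrier Q)) (left_translation Q ` carrier Q)"

definition connected_quandle :: "('a, 'm) binar_scheme \<Rightarrow> bool" where
  "connected_quandle Q \<longleftrightarrow> quandle Q \<and>
     (\<forall>x\<in>carrier Q. \<forall>y\<in>carrier Q. \<exists>g\<in>left_mult_group Q. g x = y)"

definition quandle_congruence :: "('a, 'm) binar_scheme \<Rightarrow> ('a \<times> 'a) set \<Rightarrow> bool" where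
  "quandle_congruence Q r \<longleftrightarrow> equiv (carrier Q) r \<and>
     (\<forall>(a, a')\<in>r. \<forall>(b, b')\<in>r.
        (op Q a b, op Q a' b') \<in> r \<and> (ldiv Q a b, ldiv Q a' b') \<in> r)"

text \<open>The equality congruence on \<open>Q\<close> is \<open>Id_on (carrier Q)\<close>. Intersecting with
  \<open>carrier Q \<times> carrier Q\<close> makes the empty intersection the full relation on \<open>Q\<close>
  rather than on the whole type.\<close>
definition subdirectly_irreducible :: "('a, 'm) binar_scheme \<Rightarrow> bool" where
  "subdirectly_irreducible Q \<longleftrightarrow>
     (carrier Q \<times> carrier Q) \<inter> \<Inter>{r. quandle_congruence Q r \<and> r \<noteq> Id_on (carrier Q)}
       \<noteq> Id_on (carrier Q)"

abbreviation subdirectly_reducible :: "('a, 'm) binar_scheme \<Rightarrow> bool" where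
  "subdirectly_reducible Q \<equiv> \<not> subdirectly_irreducible Q"

definition subquandle :: "'a set \<Rightarrow> ('a, 'm) binar_scheme \<Rightarrow> bool" where
  "subquandle S Q \<longleftrightarrow> S \<subseteq> carrier Q \<and>
     (\<forall>a\<in>S. \<forall>b\<in>S. op Q a b \<in> S \<and> ldiv Q a b \<in> S)"

definition more_than_one :: "'a set \<Rightarrow> bool" where
  "more_than_one S \<longleftrightarrow> (\<exists>a\<in>S. \<exists>b\<in>S. a \<noteq> b)"

definition proper_subquandle :: "'a set \<Rightarrow> ('a, 'm) binar_scheme \<Rightarrow> bool" where
  "proper_subquandle S Q \<longleftrightarrow> subquandle S Q \<and> more_than_one S \<and> S \<noteq> carrier Q"

definition strictly_simple :: "('a, 'm) binar_scheme \<Rightarrow> bool" where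
  "strictly_simple Q \<longleftrightarrow> quandle Q \<and> more_than_one (carrier Q) \<and>
     (\<nexists>S. proper_subquandle S Q)"

definition locally_strictly_simple :: "('a, 'm) binar_scheme \<Rightarrow> bool" where
  "locally_strictly_simple Q \<longleftrightarrow> quandle Q \<and> more_than_one (carrier Q) \<and>
     (\<forall>S. proper_subquandle S Q \<longrightarrow> strictly_simple (Q\<lparr>carrier := S\<rparr>))"

definition direct_product :: "'a binar \<Rightarrow> 'b binar \<Rightarrow> ('a \<times> 'b) binar" where
  "direct_product M N =
     \<lparr>carrier = carrier M \<times> carrier N, op = (\<lambda>(a, b) (c, d). (op M a c, op N b d))\<rparr>"

definition quandle_isomorphic :: "('a, 'm) binar_scheme \<Rightarrow> ('b, 'n) binar_scheme \<Rightarrow> bool" where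
  "quandle_isomorphic P Q \<longleftrightarrow>
     (\<exists>f. bij_betw f (carrier P) (carrier Q) \<and>
          (\<forall>a\<in>carrier P. \<forall>b\<in>carrier P. f (op P a b) = op Q (f a) (f b)))"

end

theory Submission
  imports Defs
begin

text \<open>
  The factors are found inside \<open>Q\<close>. A block of a congruence is a subquandle, because operations
  are idempotent, and in a connected quandle all blocks of a congruence look alike, because the left
  multiplication group permutes them transitively. So if \<open>r\<close> is a congruence other than equality and
  the full relation, each of its blocks is a proper subquandle, and strictly simple by local strict
  simplicity. Comparing blocks, two such congruences are equal or meet in equality. If they were all
  equal, that single one would be the least congruence different from equality; hence subdirect
  reducibility provides two, \<open>r\<close> and \<open>s\<close>, with \<open>r \<inter> s\<close> equality.

  The heart of the argument is that \<open>r\<close> and \<open>s\<close> are complementary: every \<open>r\<close>-block meets every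
  \<open>s\<close>-block. The union of all \<open>s\<close>-blocks that meet a given \<open>r\<close>-block is a subquandle. It properly
  contains an \<open>s\<close>-block, so it is not strictly simple, and therefore it is all of \<open>Q\<close>
  (\<open>complementary_blocks_meet\<close>).

  Fix \<open>a\<close>. Sending \<open>x\<close> to the common point of its \<open>r\<close>-block with the \<open>s\<close>-block of \<open>a\<close> is then a
  retraction of \<open>Q\<close> onto that block and a homomorphism, likewise with \<open>r\<close> and \<open>s\<close> exchanged, and
  together the two retractions are an isomorphism onto the product of the two blocks. The blocks
  are connected as homomorphic images of \<open>Q\<close> (\<open>connected_quandle_image\<close>).
\<close>

section \<open>Translations and homomorphic images\<close>

context quandle
begin

lemma op_closed: "a \<in> carrier Q \<Longrightarrow> b \<in> carrier Q \<Longrightarrow> a \<star> b \<in> carrier Q"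
  using left_translation_bij bij_betwE by blast

lemma ldiv_closed: "a \<in> carrier Q \<Longrightarrow> b \<in> carrier Q \<Longrightarrow> ldiv Q a b \<in> carrier Q"
  unfolding ldiv_def by (metis bij_betw_def inv_into_into left_translation_bij)

lemma op_ldiv: "a \<in> carrier Q \<Longrightarrow> b \<in> carrier Q \<Longrightarrow> a \<star> ldiv Q a b = b"
  unfolding ldiv_def by (metis bij_betw_def f_inv_into_f left_translation_bij)

lemma ldiv_eqI:
  "a \<in> carrier Q \<Longrightarrow> c \<in> carrier Q \<Longrightarrow> a \<star> c = b \<Longrightarrow> ldiv Q a b = c"
  unfolding ldiv_def by (metis bij_betw_def inv_into_f_f left_translation_bij)

lemma ldiv_idem: "a \<in> carrier Q \<Longrightarrow> ldiv Q a a = a"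
  by (simp add: ldiv_eqI idem)

lemma left_translation_Bij: "a \<in> carrier Q \<Longrightarrow> left_translation Q a \<in> Bij (carrier Q)"
  unfolding Bij_def left_translation_def
  using left_translation_bij[of a] by (auto cong: bij_betw_cong)

lemma inv_left_translation:
  assumes "a \<in> carrier Q" "x \<in> carrier Q"
  shows "(inv\<^bsub>BijGroup (carrier Q)\<^esub> (left_translation Q a)) x = ldiv Q a x"
proof -
  have "inv_into (carrier Q) (left_translation Q a) x = ldiv Q a x"
  proof (rule inv_into_f_eq)
    show "inj_on (left_translation Q a) (carrier Q)"
      using left_translation_Bij[OF assms(1)] by (auto simp: Bij_def bij_betw_def)
  qed (use assms in \<open>auto simp: left_translation_def ldiv_closed op_ldiv\<close>)
  then show ?thesis
    using assms by (simp add: inv_BijGroup left_translation_Bij)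
qed

lemma left_mult_group_Bij:
  assumes g: "g \<in> left_mult_group Q"
  shows "g \<in> Bij (carrier Q)"
proof -
  have "left_translation Q ` carrier Q \<subseteq> carrier (BijGroup (carrier Q))"
    by (auto simp: BijGroup_def left_translation_Bij)
  then have "g \<in> carrier (BijGroup (carrier Q))"
    using g unfolding left_mult_group_def
    by (rule group.generate_in_carrier[OF group_BijGroup])
  then show ?thesis by (simp add: BijGroup_def)
qed

text \<open>Induction over the left multiplication group, with composition and inverses in
  \<^const>\<open>BijGroup\<close> replaced by pointwise application of translations and left divisions.\<close>

lemma left_mult_group_induct [consumes 1, case_names one op ldiv comp]:
  assumes "g \<in> left_mult_group Q"
    and one: "\<And>g. (\<And>x. x \<in> carrier Q \<Longrightarrow> g x = x) \<Longrightarrow> P g"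
    and op: "\<And>g a. a \<in> carrier Q \<Longrightarrow> (\<And>x. x \<in> carrier Q \<Longrightarrow> g x = a \<star> x) \<Longrightarrow> P g"
    and ldiv: "\<And>g a. a \<in> carrier Q \<Longrightarrow> (\<And>x. x \<in> carrier Q \<Longrightarrow> g x = ldiv Q a x) \<Longrightarrow> P g"
    and comp: "\<And>f g h. P g \<Longrightarrow> P h \<Longrightarrow> g \<in> Bij (carrier Q) \<Longrightarrow> h \<in> Bij (carrier Q)
        \<Longrightarrow> (\<And>x. x \<in> carrier Q \<Longrightarrow> f x = g (h x)) \<Longrightarrow> P f"
  shows "P g"
  using assms(1) unfolding left_mult_group_def
proof (induction rule: generate.induct)
  case one
  then show ?case by (rule assms(2)) (simp add: BijGroup_def)
next
  case (incl h)
  then obtain a where "a \<in> carrier Q" "h = left_translation Q a" by blast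
  then show ?case by (intro op[of a]) (simp_all add: left_translation_def)
next
  case (inv h)
  then obtain a where "a \<in> carrier Q" "h = left_translation Q a" by blast
  then show ?case by (intro ldiv[of a]) (simp_all add: inv_left_translation)
next
  case (eng g h)
  then have "g \<in> Bij (carrier Q)" "h \<in> Bij (carrier Q)"
    using left_mult_group_Bij unfolding left_mult_group_def by simp_all
  then show ?case
    by (intro comp[OF eng.IH]) (simp_all add: BijGroup_def compose_def)
qed

lemma hom_ldiv:
  assumes "quandle R" "f \<in> carrier Q \<rightarrow> carrier R"
    and "\<And>x y. x \<in> carrier Q \<Longrightarrow> y \<in> carrier Q \<Longrightarrow> f (x \<star> y) = op R (f x) (f y)"
    and "a \<in> carrier Q" "b \<in> carrier Q"
  shows "f (ldiv Q a b) = ldiv R (f a) (f b)"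
proof (rule sym, rule quandle.ldiv_eqI[OF assms(1)])
  show "op R (f a) (f (ldiv Q a b)) = f b"
    using assms ldiv_closed op_ldiv by metis
qed (use assms ldiv_closed in auto)

text \<open>Transitivity passes to homomorphic images because a surjective homomorphism carries each
  product of translations and their inverses of \<open>Q\<close> to one of the image.\<close>

lemma connected_quandle_image:
  assumes "quandle R" "connected_quandle Q" "f ` carrier Q = carrier R"
    and hom: "\<And>x y. x \<in> carrier Q \<Longrightarrow> y \<in> carrier Q \<Longrightarrow> f (x \<star> y) = op R (f x) (f y)"
  shows "connected_quandle R"
proof -
  interpret R: quandle R by fact
  have fR: "f \<in> carrier Q \<rightarrow> carrier R" using assms(3) by blast
  have lift: "\<exists>h\<in>left_mult_group R. \<forall>x\<in>carrier Q. f (g x) = h (f x)"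
    if "g \<in> left_mult_group Q" for g
    using that
  proof (induction rule: left_mult_group_induct)
    case (one g)
    then show ?case
      using fR by (intro bexI[of _ "\<one>\<^bsub>BijGroup (carrier R)\<^esub>"])
        (simp_all add: left_mult_group_def generate.one, auto simp: BijGroup_def)
  next
    case (op g a)
    then show ?case
      using fR by (intro bexI[of _ "left_translation R (f a)"])
        (auto simp: left_mult_group_def hom left_translation_def intro!: generate.incl)
  next
    case (ldiv g a)
    then show ?case
      using fR by (intro bexI[of _ "inv\<^bsub>BijGroup (carrier R)\<^esub> (left_translation R (f a))"])
        (auto simp: left_mult_group_def R.inv_left_translation Pi_iff hom
          hom_ldiv[OF assms(1) fR] intro!: generate.inv)
  next
    case (comp k g h)
    obtain g' h' where g': "g' \<in> left_mult_group R" "\<forall>x\<in>carrier Q. f (g x) = g' (f x)"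
      and h': "h' \<in> left_mult_group R" "\<forall>x\<in>carrier Q. f (h x) = h' (f x)"
      using comp.IH by blast
    have "h x \<in> carrier Q" if "x \<in> carrier Q" for x
      using comp.hyps(2) that by (auto simp: Bij_def bij_betw_def)
    moreover have "(g' \<otimes>\<^bsub>BijGroup (carrier R)\<^esub> h') y = g' (h' y)" if "y \<in> carrier R" for y
      using that g'(1) h'(1) R.left_mult_group_Bij by (auto simp: BijGroup_def compose_def)
    ultimately show ?case
      using g' h' fR comp.hyps(3)
      by (intro bexI[of _ "g' \<otimes>\<^bsub>BijGroup (carrier R)\<^esub> h'"])
        (auto simp: left_mult_group_def Pi_iff intro!: generate.eng)
  qed
  have "\<exists>h\<in>left_mult_group R. h x = y" if xy: "x \<in> carrier R" "y \<in> carrier R" for x y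
  proof -
    obtain u v where uv: "u \<in> carrier Q" "v \<in> carrier Q" "f u = x" "f v = y"
      using xy assms(3) by (metis imageE)
    then obtain g where "g \<in> left_mult_group Q" "g u = v"
      using assms(2) unfolding connected_quandle_def by blast
    then show ?thesis
      using lift uv by metis
  qed
  then show ?thesis
    using assms(1) unfolding connected_quandle_def by blast
qed

section \<open>Congruences and their blocks\<close>

lemma congruence_op:
  "quandle_congruence Q r \<Longrightarrow> (a, a') \<in> r \<Longrightarrow> (b, b') \<in> r \<Longrightarrow> (a \<star> b, a' \<star> b') \<in> r"
  unfolding quandle_congruence_def by blast

lemma congruence_ldiv:
  "quandle_congruence Q r \<Longrightarrow> (a, a') \<in> r \<Longrightarrow> (b, b') \<in> r
    \<Longrightarrow> (ldiv Q a b, ldiv Q a' b') \<in> r"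
  unfolding quandle_congruence_def by blast

lemma congruence_in_carrier:
  "quandle_congruence Q r \<Longrightarrow> (a, b) \<in> r \<Longrightarrow> a \<in> carrier Q \<and> b \<in> carrier Q"
  unfolding quandle_congruence_def equiv_def by blast

lemma congruence_refl: "quandle_congruence Q r \<Longrightarrow> a \<in> carrier Q \<Longrightarrow> (a, a) \<in> r"
  unfolding quandle_congruence_def equiv_def refl_on_def by blast

lemma congruence_sym: "quandle_congruence Q r \<Longrightarrow> (a, b) \<in> r \<Longrightarrow> (b, a) \<in> r"
  unfolding quandle_congruence_def equiv_def by (meson symE)

lemma congruence_trans:
  "quandle_congruence Q r \<Longrightarrow> (a, b) \<in> r \<Longrightarrow> (b, c) \<in> r \<Longrightarrow> (a, c) \<in> r"
  unfolding quandle_congruence_def equiv_def by (meson transE)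

lemma congruenceI:
  assumes "r \<subseteq> carrier Q \<times> carrier Q"
    and "\<And>a. a \<in> carrier Q \<Longrightarrow> (a, a) \<in> r"
    and "\<And>a b. (a, b) \<in> r \<Longrightarrow> (b, a) \<in> r"
    and "\<And>a b c. (a, b) \<in> r \<Longrightarrow> (b, c) \<in> r \<Longrightarrow> (a, c) \<in> r"
    and "\<And>a a' b b'. (a, a') \<in> r \<Longrightarrow> (b, b') \<in> r \<Longrightarrow> (a \<star> b, a' \<star> b') \<in> r"
    and "\<And>a a' b b'. (a, a') \<in> r \<Longrightarrow> (b, b') \<in> r \<Longrightarrow> (ldiv Q a b, ldiv Q a' b') \<in> r"
  shows "quandle_congruence Q r"
  unfolding quandle_congruence_def
proof (intro conjI)
  show "equiv (carrier Q) r"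
    by (intro equivI refl_onI symI transI) (use assms(1-4) in \<open>blast intro: assms(4)\<close>)+
  show "\<forall>(a, a')\<in>r. \<forall>(b, b')\<in>r. (a \<star> b, a' \<star> b') \<in> r \<and> (ldiv Q a b, ldiv Q a' b') \<in> r"
    using assms(5,6) by blast
qed

lemma congruence_Int:
  assumes r: "quandle_congruence Q r" and s: "quandle_congruence Q s"
  shows "quandle_congruence Q (r \<inter> s)"
proof (rule congruenceI)
  show "r \<inter> s \<subseteq> carrier Q \<times> carrier Q"
    using congruence_in_carrier[OF r] by auto
  show "(a, c) \<in> r \<inter> s" if "(a, b) \<in> r \<inter> s" "(b, c) \<in> r \<inter> s" for a b c
    using that congruence_trans[OF r, of a b c] congruence_trans[OF s, of a b c] by simp
qed (simp_all add: congruence_refl r s congruence_sym congruence_op congruence_ldiv)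

lemma full_congruence: "quandle_congruence Q (carrier Q \<times> carrier Q)"
  by (rule congruenceI) (auto simp: op_closed ldiv_closed)

lemma block_subquandle:
  assumes r: "quandle_congruence Q r" and a: "a \<in> carrier Q"
  shows "subquandle (r `` {a}) Q"
  unfolding subquandle_def
  using congruence_op[OF r, of a _ a] congruence_ldiv[OF r, of a _ a]
    congruence_in_carrier[OF r] idem[OF a] ldiv_idem[OF a]
  by auto

lemma subquandle_saturation:
  assumes "subquandle S Q" and r: "quandle_congruence Q r"
  shows "subquandle (r `` S) Q"
  using assms(1) congruence_op[OF r] congruence_ldiv[OF r] congruence_in_carrier[OF r]
  unfolding subquandle_def by blast

lemma proper_congruence_block_neq:
  assumes r: "quandle_congruence Q r" and "r \<noteq> carrier Q \<times> carrier Q"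
  shows "r `` {a} \<noteq> carrier Q"
proof
  assume "r `` {a} = carrier Q"
  then have "carrier Q \<times> carrier Q \<subseteq> r"
    using congruence_sym[OF r] congruence_trans[OF r] by blast
  then show False
    using assms(2) congruence_in_carrier[OF r] by auto
qed

text \<open>An element of the left multiplication group that moves one end of a related pair of distinct
  points to \<open>a\<close> moves the other end to a second point of the block of \<open>a\<close>.\<close>

lemma connected_block_more_than_one:
  assumes "connected_quandle Q" and r: "quandle_congruence Q r"
    and "r \<noteq> Id_on (carrier Q)" and a: "a \<in> carrier Q"
  shows "more_than_one (r `` {a})"
proof -
  have "Id_on (carrier Q) \<subseteq> r"
    using congruence_refl[OF r] by blast
  then obtain u v where uv: "(u, v) \<in> r" "(u, v) \<notin> Id_on (carrier Q)"
    using assms(3) by (metis subrelI subset_antisym)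
  have uvQ: "u \<in> carrier Q" "v \<in> carrier Q"
    using congruence_in_carrier[OF r uv(1)] by auto
  then have "u \<noteq> v" using uv(2) by blast
  obtain g where g: "g \<in> left_mult_group Q" "g u = a"
    using assms(1) a uvQ unfolding connected_quandle_def by blast
  have pres: "\<forall>x y. (x, y) \<in> r \<longrightarrow> (g x, g y) \<in> r"
    using g(1)
  proof (induction rule: left_mult_group_induct)
    case (one g)
    then show ?case using congruence_in_carrier[OF r] by metis
  next
    case (op g b)
    then show ?case
      using congruence_in_carrier[OF r] congruence_op[OF r] congruence_refl[OF r] by metis
  next
    case (ldiv g b)
    then show ?case
      using congruence_in_carrier[OF r] congruence_ldiv[OF r] congruence_refl[OF r] by metis
  next
    case (comp f g h)
    then show ?case using congruence_in_carrier[OF r] by metis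
  qed
  have "g v \<noteq> a"
    using left_mult_group_Bij[OF g(1)] g(2) \<open>u \<noteq> v\<close> uvQ
    by (auto simp: Bij_def bij_betw_def inj_on_def)
  moreover have "(a, g v) \<in> r" using pres uv(1) g(2) by blast
  ultimately show ?thesis
    unfolding more_than_one_def using congruence_refl[OF r a] by blast
qed

lemma proper_subquandle_block:
  assumes "connected_quandle Q" "quandle_congruence Q r"
    and "r \<noteq> Id_on (carrier Q)" "r \<noteq> carrier Q \<times> carrier Q" "a \<in> carrier Q"
  shows "proper_subquandle (r `` {a}) Q"
  unfolding proper_subquandle_def
  using assms block_subquandle connected_block_more_than_one proper_congruence_block_neq by simp

section \<open>Complementary congruences from local strict simplicity\<close>

text \<open>In a locally strictly simple quandle the proper subquandles form an antichain. Left division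
  computed in a subquandle has to be identified with that of \<open>Q\<close>.\<close>

lemma proper_subquandle_minimal:
  assumes "locally_strictly_simple Q" and S: "proper_subquandle S Q"
    and T: "subquandle T Q" "more_than_one T" "T \<subseteq> S"
  shows "T = S"
proof (rule ccontr)
  assume "T \<noteq> S"
  have SQ: "S \<subseteq> carrier Q"
    using S unfolding proper_subquandle_def subquandle_def by blast
  have "ldiv (Q\<lparr>carrier := S\<rparr>) a b = ldiv Q a b" if ab: "a \<in> T" "b \<in> T" for a b
  proof -
    have "a \<in> carrier Q" "b \<in> carrier Q" "ldiv Q a b \<in> S"
      using ab T SQ unfolding subquandle_def by auto
    moreover have "inj_on (op Q a) S"
      using left_translation_bij[OF \<open>a \<in> carrier Q\<close>] SQ
      by (auto simp: bij_betw_def intro: inj_on_subset)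
    ultimately have "inv_into S (op Q a) b = ldiv Q a b"
      by (intro inv_into_f_eq) (auto simp: op_ldiv)
    then show ?thesis by (simp add: ldiv_def)
  qed
  then have "proper_subquandle T (Q\<lparr>carrier := S\<rparr>)"
    using T \<open>T \<noteq> S\<close> unfolding proper_subquandle_def subquandle_def by simp
  then show False
    using assms(1) S unfolding locally_strictly_simple_def strictly_simple_def by blast
qed

text \<open>If \<open>r \<inter> s\<close> is not equality, its blocks have more than one element, so by minimality each of
  them is the whole \<open>r\<close>-block containing it.\<close>

lemma congruence_le_if_Int_nontrivial:
  assumes "connected_quandle Q" "locally_strictly_simple Q"
    and r: "quandle_congruence Q r" "r \<noteq> carrier Q \<times> carrier Q"
    and s: "quandle_congruence Q s"
    and rs: "r \<inter> s \<noteq> Id_on (carrier Q)"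
  shows "r \<subseteq> s"
proof
  fix p assume "p \<in> r"
  then obtain x y where xy: "p = (x, y)" "(x, y) \<in> r" by (cases p) auto
  have x: "x \<in> carrier Q" using congruence_in_carrier[OF r(1) xy(2)] by simp
  have "r \<noteq> Id_on (carrier Q)"
    using rs congruence_refl[OF s] by auto
  then have "proper_subquandle (r `` {x}) Q"
    using assms x by (intro proper_subquandle_block)
  then have "(r \<inter> s) `` {x} = r `` {x}"
    using assms x congruence_Int
    by (intro proper_subquandle_minimal block_subquandle connected_block_more_than_one) auto
  then show "p \<in> s" using xy by blast
qed

text \<open>If all congruences other than equality and the full relation coincided, that common one (or the
  full relation, if there are none) would be the intersection of all congruences different from
  equality.\<close>

lemma subdirectly_reducible_two_congruences:
  assumes "subdirectly_reducible Q" "more_than_one (carrier Q)"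
  obtains r s where "quandle_congruence Q r" "r \<noteq> Id_on (carrier Q)" "r \<noteq> carrier Q \<times> carrier Q"
    and "quandle_congruence Q s" "s \<noteq> Id_on (carrier Q)" "s \<noteq> carrier Q \<times> carrier Q"
    and "r \<noteq> s"
proof -
  let ?full = "carrier Q \<times> carrier Q"
  let ?C = "{r. quandle_congruence Q r \<and> r \<noteq> Id_on (carrier Q)}"
  have inter: "?full \<inter> \<Inter>?C = Id_on (carrier Q)"
    using assms(1) unfolding subdirectly_irreducible_def by simp
  have full: "?full \<noteq> Id_on (carrier Q)"
    using assms(2) unfolding more_than_one_def by blast
  have sub: "r \<subseteq> ?full" if "r \<in> ?C" for r
    using that congruence_in_carrier by auto
  have least: "\<exists>s\<in>?C. \<not> r \<subseteq> s" if "r \<in> ?C" for r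
  proof (rule ccontr)
    assume "\<not> ?thesis"
    then have "?full \<inter> \<Inter>?C = r" using that sub by blast
    then show False using inter that by simp
  qed
  obtain r where r: "r \<in> ?C" "r \<noteq> ?full"
    using least[of ?full] full full_congruence by blast
  obtain s where s: "s \<in> ?C" "\<not> r \<subseteq> s"
    using least[OF r(1)] by blast
  then have "s \<noteq> ?full" "r \<noteq> s" using sub r by auto
  then show thesis using r s that by blast
qed

text \<open>The saturation of the \<open>r\<close>-block of \<open>x\<close> under \<open>s\<close> contains the \<open>r\<close>-block and the \<open>s\<close>-block of
  \<open>x\<close>. Were it proper, minimality would make it equal to the \<open>s\<close>-block, so that the \<open>r\<close>-block would
  lie in the \<open>s\<close>-block and be a singleton.\<close>

lemma complementary_blocks_meet:
  assumes "connected_quandle Q" "locally_strictly_simple Q"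
    and r: "quandle_congruence Q r" "r \<noteq> Id_on (carrier Q)"
    and s: "quandle_congruence Q s" "s \<noteq> Id_on (carrier Q)"
    and rs: "r \<inter> s = Id_on (carrier Q)"
    and x: "x \<in> carrier Q" and y: "y \<in> carrier Q"
  shows "\<exists>z. (x, z) \<in> r \<and> (z, y) \<in> s"
proof -
  let ?S = "s `` (r `` {x})"
  have S: "subquandle ?S Q"
    using subquandle_saturation[OF block_subquandle[OF r(1) x] s(1)] .
  have rS: "r `` {x} \<subseteq> ?S"
    using congruence_in_carrier[OF r(1)] congruence_refl[OF s(1)] by blast
  have sS: "s `` {x} \<subseteq> ?S"
    using congruence_refl[OF r(1) x] by blast
  have more_r: "more_than_one (r `` {x})" and more_s: "more_than_one (s `` {x})"
    using assms by (auto intro!: connected_block_more_than_one)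
  have "?S = carrier Q"
  proof (rule ccontr)
    assume "?S \<noteq> carrier Q"
    then have "proper_subquandle ?S Q"
      using S rS more_r unfolding proper_subquandle_def more_than_one_def by blast
    then have "s `` {x} = ?S"
      using proper_subquandle_minimal[OF assms(2)] block_subquandle[OF s(1) x] more_s sS by blast
    then have "r `` {x} \<subseteq> {x}" using rS rs by blast
    then show False using more_r unfolding more_than_one_def by blast
  qed
  then show ?thesis using y by blast
qed

section \<open>Decomposition along complementary congruences\<close>

definition block_projection :: "('a \<times> 'a) set \<Rightarrow> ('a \<times> 'a) set \<Rightarrow> 'a \<Rightarrow> 'a \<Rightarrow> 'a" where
  "block_projection r s a x = (THE z. (x, z) \<in> r \<and> (a, z) \<in> s)"

end

locale complementary_congruences = quandle +
  fixes r s :: "('a \<times> 'a) set"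
  assumes r: "quandle_congruence Q r" and s: "quandle_congruence Q s"
    and Int_trivial: "r \<inter> s = Id_on (carrier Q)"
    and meet: "\<And>x y. x \<in> carrier Q \<Longrightarrow> y \<in> carrier Q \<Longrightarrow> \<exists>z. (x, z) \<in> r \<and> (z, y) \<in> s"
begin

lemma block_projection_unique:
  "(x, z) \<in> r \<Longrightarrow> (a, z) \<in> s \<Longrightarrow> (x, z') \<in> r \<Longrightarrow> (a, z') \<in> s \<Longrightarrow> z = z'"
  using congruence_sym[OF r] congruence_trans[OF r] congruence_sym[OF s] congruence_trans[OF s]
    Int_trivial by blast

lemma block_projection_eqI:
  assumes "(x, z) \<in> r" "(a, z) \<in> s"
  shows "block_projection r s a x = z"
  unfolding block_projection_def
  by (rule the_equality) (use assms block_projection_unique in blast)+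

lemma block_projection:
  assumes "a \<in> carrier Q" "x \<in> carrier Q"
  shows "(x, block_projection r s a x) \<in> r" "(a, block_projection r s a x) \<in> s"
  using meet[OF assms(2,1)] block_projection_eqI congruence_sym[OF s] by blast+

text \<open>The product of two projections lies in the \<open>s\<close>-block of \<open>a\<close> because \<open>a \<star> a = a\<close>, and it is
  related to \<open>x \<star> y\<close> by \<open>r\<close>; uniqueness of the common point does the rest.\<close>

lemma block_projection_hom:
  assumes a: "a \<in> carrier Q" and xy: "x \<in> carrier Q" "y \<in> carrier Q"
  shows "block_projection r s a (x \<star> y) = block_projection r s a x \<star> block_projection r s a y"
proof (rule block_projection_eqI)
  show "(x \<star> y, block_projection r s a x \<star> block_projection r s a y) \<in> r"
    using a xy block_projection congruence_op[OF r] by blast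
  show "(a, block_projection r s a x \<star> block_projection r s a y) \<in> s"
    using congruence_op[OF s block_projection(2)[OF a xy(1)] block_projection(2)[OF a xy(2)]]
    by (simp add: idem a)
qed

lemma block_projection_image:
  assumes a: "a \<in> carrier Q"
  shows "block_projection r s a ` carrier Q = s `` {a}"
proof
  show "block_projection r s a ` carrier Q \<subseteq> s `` {a}"
    using block_projection a by blast
  show "s `` {a} \<subseteq> block_projection r s a ` carrier Q"
  proof
    fix z assume z: "z \<in> s `` {a}"
    then have "z \<in> carrier Q" using congruence_in_carrier[OF s] by blast
    moreover have "block_projection r s a z = z"
      using z block_projection_eqI congruence_refl[OF r \<open>z \<in> carrier Q\<close>] by blast
    ultimately show "z \<in> block_projection r s a ` carrier Q" by force
  qed
qed

lemma connected_block:
  assumes "connected_quandle Q" "a \<in> carrier Q" "quandle (Q\<lparr>carrier := s `` {a}\<rparr>)"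
  shows "connected_quandle (Q\<lparr>carrier := s `` {a}\<rparr>)"
  by (rule connected_quandle_image[OF assms(3,1), of "block_projection r s a"])
    (simp_all add: assms block_projection_image block_projection_hom)

lemma swap: "complementary_congruences Q s r"
proof unfold_locales
  show "s \<inter> r = Id_on (carrier Q)"
    using Int_trivial by (simp add: Int_commute)
  fix x y assume "x \<in> carrier Q" "y \<in> carrier Q"
  then obtain z where "(y, z) \<in> r" "(z, x) \<in> s"
    using meet[of y x] by blast
  then show "\<exists>z. (x, z) \<in> s \<and> (z, y) \<in> r"
    using congruence_sym[OF r, of y z] congruence_sym[OF s, of z x] by blast
qed (fact s, fact r)

end

text \<open>A point is recovered from its two projections as the common point of the \<open>r\<close>-block of the
  first and the \<open>s\<close>-block of the second.\<close>

lemma complementary_congruences_product: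
  fixes Q :: "'a binar"
  assumes "complementary_congruences Q r s" and a: "a \<in> carrier Q"
  shows "quandle_isomorphic Q
    (direct_product (Q\<lparr>carrier := s `` {a}\<rparr>) (Q\<lparr>carrier := r `` {a}\<rparr>))"
proof -
  interpret complementary_congruences Q r s by fact
  interpret swapped: complementary_congruences Q s r by (rule swap)
  define f where "f x = (block_projection r s a x, block_projection s r a x)" for x
  have "bij_betw f (carrier Q) (s `` {a} \<times> r `` {a})"
  proof (rule bij_betwI')
    fix x y assume xy: "x \<in> carrier Q" "y \<in> carrier Q"
    show "(f x = f y) = (x = y)"
    proof
      assume "f x = f y"
      then have eq: "block_projection r s a x = block_projection r s a y"
          "block_projection s r a x = block_projection s r a y"
        by (simp_all add: f_def)
      have "(x, y) \<in> r"
        using congruence_trans[OF r block_projection(1)[OF a xy(1)]]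
          congruence_sym[OF r block_projection(1)[OF a xy(2)]] by (simp add: eq(1))
      moreover have "(x, y) \<in> s"
        using congruence_trans[OF s swapped.block_projection(1)[OF a xy(1)]]
          congruence_sym[OF s swapped.block_projection(1)[OF a xy(2)]] by (simp add: eq(2))
      ultimately have "(x, y) \<in> Id_on (carrier Q)"
        unfolding Int_trivial[symmetric] by simp
      then show "x = y" by blast
    qed simp
  next
    fix x assume x: "x \<in> carrier Q"
    show "f x \<in> s `` {a} \<times> r `` {a}"
      using block_projection(2)[OF a x] swapped.block_projection(2)[OF a x]
      by (simp add: f_def)
  next
    fix p assume "p \<in> s `` {a} \<times> r `` {a}"
    then obtain u v where uv: "p = (u, v)" "(a, u) \<in> s" "(a, v) \<in> r" by blast
    then have "u \<in> carrier Q" "v \<in> carrier Q"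
      using congruence_in_carrier[OF r uv(3)] congruence_in_carrier[OF s uv(2)] by simp_all
    then obtain z where z: "(u, z) \<in> r" "(z, v) \<in> s"
      using meet by blast
    have "f z = p"
      unfolding f_def uv(1) prod.inject
      using block_projection_eqI[OF congruence_sym[OF r z(1)] uv(2)]
        swapped.block_projection_eqI[OF z(2) uv(3)] by simp
    moreover have "z \<in> carrier Q"
      using congruence_in_carrier[OF r z(1)] by simp
    ultimately show "\<exists>z\<in>carrier Q. p = f z" by blast
  qed
  then show ?thesis
    unfolding quandle_isomorphic_def direct_product_def
    by (intro exI[of _ f])
      (simp add: f_def a block_projection_hom swapped.block_projection_hom)
qed

section \<open>The decomposition theorem\<close>

theorem theorem2p6:
  fixes Q :: "'a binar"
  assumes "finite (carrier Q)"
    and "connected_quandle Q"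
    and "subdirectly_reducible Q"
    and "locally_strictly_simple Q"
  shows "\<exists>(M :: 'a binar) (N :: 'a binar).
           connected_quandle M \<and> strictly_simple M \<and>
           connected_quandle N \<and> strictly_simple N \<and>
           quandle_isomorphic Q (direct_product M N)"
proof -
  interpret quandle Q
    using assms(2) unfolding connected_quandle_def by simp
  have more: "more_than_one (carrier Q)"
    using assms(4) unfolding locally_strictly_simple_def by simp
  obtain a where a: "a \<in> carrier Q"
    using more unfolding more_than_one_def by blast
  obtain r s where r: "quandle_congruence Q r" "r \<noteq> Id_on (carrier Q)" "r \<noteq> carrier Q \<times> carrier Q"
    and s: "quandle_congruence Q s" "s \<noteq> Id_on (carrier Q)" "s \<noteq> carrier Q \<times> carrier Q"
    and "r \<noteq> s"
    using subdirectly_reducible_two_congruences[OF assms(3) more] by blast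
  have rs: "r \<inter> s = Id_on (carrier Q)"
  proof (rule ccontr)
    assume "r \<inter> s \<noteq> Id_on (carrier Q)"
    then have "r \<subseteq> s" "s \<subseteq> r"
      using congruence_le_if_Int_nontrivial[OF assms(2,4) r(1,3) s(1)]
        congruence_le_if_Int_nontrivial[OF assms(2,4) s(1,3) r(1)]
      by (simp_all add: Int_commute[of s r])
    then show False using \<open>r \<noteq> s\<close> by blast
  qed
  let ?M = "Q\<lparr>carrier := s `` {a}\<rparr>" and ?N = "Q\<lparr>carrier := r `` {a}\<rparr>"
  have simple: "strictly_simple ?M" "strictly_simple ?N"
    using proper_subquandle_block[OF assms(2) s(1-3) a]
      proper_subquandle_block[OF assms(2) r(1-3) a]
      assms(4) unfolding locally_strictly_simple_def by simp_all
  then have quandles: "quandle ?M" "quandle ?N"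
    unfolding strictly_simple_def by simp_all
  interpret complementary_congruences Q r s
    using complementary_blocks_meet[OF assms(2,4) r(1,2) s(1,2) rs] r(1) s(1) rs
    by unfold_locales
  interpret swapped: complementary_congruences Q s r by (rule swap)
  have "connected_quandle ?M" "connected_quandle ?N"
    using connected_block[OF assms(2) a] swapped.connected_block[OF assms(2) a] quandles
    by simp_all
  then show ?thesis
    using simple complementary_congruences_product[OF complementary_congruences_axioms a] by blast
qed

end
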